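(* Let $\Omega\subset\mathbb{R}^n$ be open and $f\in C(\Omega)$. For each $x\in\Omega$ let $\mathbb{A}_x$ be a non-empty collection of subsets of $S^n_+(\mathbb{R})$ such that $$\bigcup\mathbb{A}_x=\{A\in S^n_+(\mathbb{R}):A\in\mathcal{A}\text{ for some }\mathcal{A}\in\mathbb{A}_x\}\quad\text{is bounded},$$ and let $F:\Omega\times S^n(\mathbb{R})\to\mathbb{R}$ be given by $$F(x,M)=\sup_{\mathcal{A}\in\mathbb{A}_x}\ \inf_{A\in\mathcal{A}}\operatorname{trace}(A^tMA).$$ Then a function $u\in C(\Omega)$ is a viscosity subsolution (respectively, supersolution) of $$F(x,D^2u(x))=f(x)\quad\text{in }\Omega$$ if and only if $$u(x)\le\sup_{\mathcal{A}\in\mathbb{A}_x}\ \inf_{A\in\mathcal{A}}\ \frac{1}{|B_\varepsilon(0)|}\int_{B_\varepsilon(0)}u(x+Ay)\,dy-\frac{\varepsilon^2}{2(n+2)}f(x)+o(\varepsilon^2)\qquad\text{as }\varepsilon\to0$$ (respectively, $\ge$) in the viscosity sense.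
   Context: $S^n(\mathbb{R})$ is the set of real symmetric $n\times n$ matrices and $S^n_+(\mathbb{R})$ the subset of positive semi-definite ones. The bound on $\bigcup\mathbb{A}_x$ may depend on $x$. $F$ being real-valued entails that the sets $\mathcal{A}\in\mathbb{A}_x$ are non-empty. A $C^2$ function $\psi$ touches $u$ at $x\in\Omega$ strictly from below (above) if $u-\psi$ has a strict minimum (maximum) at $x$ with $u(x)=\psi(x)$. Viscosity solutions: $u$ is a viscosity subsolution of $F(x,D^2u)=f$ in $\Omega$ if $F(x,D^2\psi(x))\ge f(x)$ whenever a $C^2$ function $\psi$ touches $u$ at $x\in\Omega$ strictly from above; a viscosity supersolution if $F(x,D^2\psi(x))\le f(x)$ whenever a $C^2$ function $\psi$ touches $u$ at $x\in\Omega$ strictly from below. Mean-value inequalities in the viscosity sense: with $$M(u,\varepsilon)(x)=\sup_{\mathcal{A}\in\mathbb{A}_x}\inf_{A\in\mathcal{A}}\frac{1}{|B_\varepsilon(0)|}\int_{B_\varepsilon(0)}u(x+Ay)\,dy-\frac{\varepsilon^2}{2(n+2)}f(x),$$ a continuous $u$ satisfies $u(x)\le M(u,\varepsilon)(x)+o(\varepsilon^2)$ in the viscosity sense if $\psi(x)\le M(\psi,\varepsilon)(x)+o(\varepsilon^2)$ as $\varepsilon\to0$ for every $C^2$ function $\psi$ touching $u$ at a point $x\in\Omega$ strictly from above, and $u(x)\ge M(u,\varepsilon)(x)+o(\varepsilon^2)$ in the viscosity sense if $\psi(x)\ge M(\psi,\varepsilon)(x)+o(\varepsilon^2)$ as $\varepsilon\to0$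 for every $C^2$ function $\psi$ touching $u$ at a point $x\in\Omega$ strictly from below. (Here $o(\varepsilon^2)$ may depend on $\psi$ and $x$.) *)

theory Defs
  imports "HOL-Analysis.Analysis" "HOL-Library.Landau_Symbols"
begin

definition psd_matrices :: "(real ^ 'n ^ 'n) set" where
  "psd_matrices = {A. transpose A = A \<and> (\<forall>v. 0 \<le> v \<bullet> (A *v v))}"

definition gradient :: "(real ^ 'n \<Rightarrow> real) \<Rightarrow> real ^ 'n \<Rightarrow> real ^ 'n" where
  "gradient \<psi> x = (\<chi> i. frechet_derivative \<psi> (at x) (axis i 1))"

definition hessian :: "(real ^ 'n \<Rightarrow> real) \<Rightarrow> real ^ 'n \<Rightarrow> real ^ 'n ^ 'n" where
  "hessian \<psi> x = matrix (frechet_derivative (gradient \<psi>) (at x))"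

text \<open>Continuity of \<open>\<psi>\<close> and of its gradient on \<open>\<Omega>\<close> is implied by differentiability.\<close>

definition C2_on :: "(real ^ 'n) set \<Rightarrow> (real ^ 'n \<Rightarrow> real) \<Rightarrow> bool" where
  "C2_on \<Omega> \<psi> \<longleftrightarrow>
     (\<forall>x\<in>\<Omega>. \<psi> differentiable (at x)) \<and>
     (\<forall>x\<in>\<Omega>. gradient \<psi> differentiable (at x)) \<and>
     continuous_on \<Omega> (hessian \<psi>)"

definition touches_strictly_below ::
  "(real ^ 'n) set \<Rightarrow> (real ^ 'n \<Rightarrow> real) \<Rightarrow> (real ^ 'n \<Rightarrow> real) \<Rightarrow> real ^ 'n \<Rightarrow> bool" where
  "touches_strictly_below \<Omega> \<psi> u x \<longleftrightarrow>
     u x = \<psi> x \<and> (\<forall>y\<in>\<Omega>. y \<noteq> x \<longrightarrow> u x - \<psi> x < u y - \<psi> y)"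

definition touches_strictly_above ::
  "(real ^ 'n) set \<Rightarrow> (real ^ 'n \<Rightarrow> real) \<Rightarrow> (real ^ 'n \<Rightarrow> real) \<Rightarrow> real ^ 'n \<Rightarrow> bool" where
  "touches_strictly_above \<Omega> \<psi> u x \<longleftrightarrow>
     u x = \<psi> x \<and> (\<forall>y\<in>\<Omega>. y \<noteq> x \<longrightarrow> u y - \<psi> y < u x - \<psi> x)"

definition viscosity_subsolution ::
  "(real ^ 'n) set \<Rightarrow> (real ^ 'n \<Rightarrow> real ^ 'n ^ 'n \<Rightarrow> real) \<Rightarrow> (real ^ 'n \<Rightarrow> real) \<Rightarrow>
    (real ^ 'n \<Rightarrow> real) \<Rightarrow> bool" where
  "viscosity_subsolution \<Omega> F f u \<longleftrightarrow>
     (\<forall>\<psi>. \<forall>x\<in>\<Omega>. C2_on \<Omega> \<psi> \<and> touches_strictly_above \<Omega> \<psi> u x \<longrightarrow> F x (hessian \<psi> x) \<ge> f x)"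

definition viscosity_supersolution ::
  "(real ^ 'n) set \<Rightarrow> (real ^ 'n \<Rightarrow> real ^ 'n ^ 'n \<Rightarrow> real) \<Rightarrow> (real ^ 'n \<Rightarrow> real) \<Rightarrow>
    (real ^ 'n \<Rightarrow> real) \<Rightarrow> bool" where
  "viscosity_supersolution \<Omega> F f u \<longleftrightarrow>
     (\<forall>\<psi>. \<forall>x\<in>\<Omega>. C2_on \<Omega> \<psi> \<and> touches_strictly_below \<Omega> \<psi> u x \<longrightarrow> F x (hessian \<psi> x) \<le> f x)"

definition sup_inf_trace ::
  "(real ^ 'n \<Rightarrow> (real ^ 'n ^ 'n) set set) \<Rightarrow> real ^ 'n \<Rightarrow> real ^ 'n ^ 'n \<Rightarrow> real" where
  "sup_inf_trace \<AA> x M = (SUP \<A>\<in>\<AA> x. INF A\<in>\<A>. trace (transpose A ** M ** A))"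

definition ball_average :: "(real ^ 'n \<Rightarrow> real) \<Rightarrow> real \<Rightarrow> real ^ 'n \<Rightarrow> real ^ 'n ^ 'n \<Rightarrow> real" where
  "ball_average u \<epsilon> x A =
     1 / measure lborel (ball (0 :: real ^ 'n) \<epsilon>) * (LINT y:ball 0 \<epsilon>|lborel. u (x + A *v y))"

text \<open>
  If \<open>u\<close> is continuous on an open set containing \<open>x\<close> and the union of \<open>\<AA> x\<close> is bounded, the
  points \<open>x + A *v y\<close> stay in a compact subset of that open set for all small \<open>\<epsilon>\<close>; then
  the real supremum and infimum below are taken over bounded sets. Values for large \<open>\<epsilon>\<close> are
  irrelevant, as only the limit \<open>\<epsilon> \<rightarrow> 0\<close> is considered.
\<close>

definition mean_value ::
  "(real ^ 'n \<Rightarrow> (real ^ 'n ^ 'n) set set) \<Rightarrow> (real ^ 'n \<Rightarrow> real) \<Rightarrow>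
    (real ^ 'n \<Rightarrow> real) \<Rightarrow> real \<Rightarrow> real ^ 'n \<Rightarrow> real" where
  "mean_value \<AA> f u \<epsilon> x =
     (SUP \<A>\<in>\<AA> x. INF A\<in>\<A>. ball_average u \<epsilon> x A)
       - \<epsilon>\<^sup>2 / (2 * (real CARD('n) + 2)) * f x"

definition mean_value_sub_viscosity ::
  "(real ^ 'n) set \<Rightarrow> (real ^ 'n \<Rightarrow> (real ^ 'n ^ 'n) set set) \<Rightarrow> (real ^ 'n \<Rightarrow> real) \<Rightarrow>
    (real ^ 'n \<Rightarrow> real) \<Rightarrow> bool" where
  "mean_value_sub_viscosity \<Omega> \<AA> f u \<longleftrightarrow>
     (\<forall>\<psi>. \<forall>x\<in>\<Omega>. C2_on \<Omega> \<psi> \<and> touches_strictly_above \<Omega> \<psi> u x \<longrightarrow>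
       (\<exists>r \<in> o[at_right 0](\<lambda>\<epsilon>. \<epsilon>\<^sup>2).
          \<forall>\<^sub>F \<epsilon> in at_right 0. \<psi> x \<le> mean_value \<AA> f \<psi> \<epsilon> x + r \<epsilon>))"

definition mean_value_super_viscosity ::
  "(real ^ 'n) set \<Rightarrow> (real ^ 'n \<Rightarrow> (real ^ 'n ^ 'n) set set) \<Rightarrow> (real ^ 'n \<Rightarrow> real) \<Rightarrow>
    (real ^ 'n \<Rightarrow> real) \<Rightarrow> bool" where
  "mean_value_super_viscosity \<Omega> \<AA> f u \<longleftrightarrow>
     (\<forall>\<psi>. \<forall>x\<in>\<Omega>. C2_on \<Omega> \<psi> \<and> touches_strictly_below \<Omega> \<psi> u x \<longrightarrow>
       (\<exists>r \<in> o[at_right 0](\<lambda>\<epsilon>. \<epsilon>\<^sup>2).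
          \<forall>\<^sub>F \<epsilon> in at_right 0. \<psi> x \<ge> mean_value \<AA> f \<psi> \<epsilon> x + r \<epsilon>))"

end

theory Submission imports Defs begin

text \<open>
  The test functions are the same on both sides, so the equivalence is proved for each touching
  pair \<open>(\<psi>, x)\<close> separately. Inserting the second-order Taylor expansion of \<open>\<psi>\<close> at \<open>x\<close> into the
  average over \<open>x + A B\<^sub>\<epsilon>\<close>, the linear term vanishes by symmetry and the second moments of the ball
  turn the quadratic term into \<open>\<epsilon>\<^sup>2 / (2 (n + 2)) trace (A\<^sup>t D\<^sup>2\<psi>(x) A)\<close>. Because the matrices are
  bounded, the error is \<open>o(\<epsilon>\<^sup>2)\<close> uniformly in \<open>A\<close> and survives the supremum and infimum:
  \<open>M(\<psi>, \<epsilon>)(x) = \<psi>(x) + \<epsilon>\<^sup>2 / (2 (n + 2)) (F(x, D\<^sup>2\<psi>(x)) - f(x)) + o(\<epsilon>\<^sup>2)\<close>.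
  Dividing by \<open>\<epsilon>\<^sup>2\<close> compares the signs.
\<close>

section \<open>Invariance of Lebesgue measure under signed coordinate permutations\<close>

text \<open>Lebesgue measure is determined by its values on boxes, and the preimage of a box is a
  box with the same side lengths in another order. These maps supply the symmetries of the ball from
  which its moments are computed.\<close>

lemma lborel_distr_signed_permutation:
  fixes p :: "'n::finite \<Rightarrow> 'n" and s :: "'n \<Rightarrow> real"
  assumes p: "bij p" and s: "\<And>i. \<bar>s i\<bar> = 1"
  shows "distr lborel borel (\<lambda>x::real^'n. \<chi> i. s i * x $ p i) = lborel"
proof (rule lborel_eqI[symmetric])
  let ?T = "\<lambda>x::real^'n. \<chi> i. s i * x $ p i"
  have T: "?T \<in> borel_measurable lborel"
    by (simp, intro borel_measurable_continuous_onI continuous_intros)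
  fix l u :: "real^'n"
  assume "\<And>b. b \<in> Basis \<Longrightarrow> l \<bullet> b \<le> u \<bullet> b"
  then have lu: "l $ i \<le> u $ i" for i
    by (metis axis_in_Basis_iff cart_eq_inner_axis Basis_real_def singletonI)
  define q where "q = inv p"
  have pq: "p (q j) = j" "q (p j) = j" for j
    using p by (auto simp: q_def bij_is_surj surj_f_inv_f bij_is_inj)
  have bq: "bij q" using p unfolding q_def by (rule bij_imp_bij_inv)
  \<comment> \<open>Input coordinate \<open>j\<close> feeds output coordinate \<open>q j\<close>; a
    sign -1 there negates and swaps the two endpoints.\<close>
  define l' where "l' = (\<chi> j. if s (q j) = 1 then l $ q j else - u $ q j)"
  define u' where "u' = (\<chi> j. if s (q j) = 1 then u $ q j else - l $ q j)"
  have s2: "s i = 1 \<or> s i = -1" for i using s[of i] by linarith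
  have "(l $ i < s i * x $ p i \<and> s i * x $ p i < u $ i) \<longleftrightarrow>
        (l' $ p i < x $ p i \<and> x $ p i < u' $ p i)" for i and x :: "real^'n"
    using s2[of i] by (auto simp: l'_def u'_def pq)
  then have "?T x \<in> box l u \<longleftrightarrow> (\<forall>i. l' $ p i < x $ p i \<and> x $ p i < u' $ p i)" for x
    by (simp add: mem_box_cart)
  also have "\<dots> x \<longleftrightarrow> (\<forall>i. l' $ i < x $ i \<and> x $ i < u' $ i)" for x
    by (metis pq(1))
  finally have "?T -` box l u = box l' u'"
    by (auto simp: mem_box_cart)
  then have "emeasure (distr lborel borel ?T) (box l u) = emeasure lborel (box l' u')"
    using T by (subst emeasure_distr) auto
  also have "\<dots> = ennreal (\<Prod>b\<in>Basis. (u' - l') \<bullet> b)"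
    using lu by (intro emeasure_lborel_box) (auto simp: Basis_vec_def inner_axis l'_def u'_def)
  also have "(\<Prod>b\<in>Basis. (u' - l') \<bullet> b) = (\<Prod>j\<in>UNIV. (u' - l') $ j)"
    by (subst Basis_vec_def)
       (simp add: UNION_singleton_eq_range prod.reindex inj_def axis_eq_axis inner_axis)
  also have "\<dots> = (\<Prod>j\<in>UNIV. (u - l) $ q j)"
    by (intro prod.cong) (auto simp: l'_def u'_def)
  also have "\<dots> = (\<Prod>i\<in>UNIV. (u - l) $ i)"
    using prod.reindex_bij_betw[OF bq] .
  also have "\<dots> = (\<Prod>b\<in>Basis. (u - l) \<bullet> b)"
    by (subst Basis_vec_def)
       (simp add: UNION_singleton_eq_range prod.reindex inj_def axis_eq_axis inner_axis)
  finally show "emeasure (distr lborel borel ?T) (box l u) = (\<Prod>b\<in>Basis. (u - l) \<bullet> b)" .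
qed simp

text \<open>A signed permutation preserves the norm, hence the ball, as well as Lebesgue measure, so
  this is a change of variables.\<close>

lemma set_integral_ball_signed_permutation:
  fixes p :: "'n::finite \<Rightarrow> 'n" and s :: "'n \<Rightarrow> real" and h :: "real^'n \<Rightarrow> real"
  assumes p: "bij p" and s: "\<And>i. \<bar>s i\<bar> = 1" and h: "h \<in> borel_measurable borel"
  shows "(LINT y:ball 0 r|lborel. h (\<chi> i. s i * y $ p i)) = (LINT y:ball 0 r|lborel. h y)"
proof -
  let ?T = "\<lambda>x::real^'n. \<chi> i. s i * x $ p i"
  have T: "?T \<in> borel_measurable lborel"
    by (simp, intro borel_measurable_continuous_onI continuous_intros)
  have n: "norm (?T y) = norm y" for y
  proof -
    have "s i * y $ p i * (s i * y $ p i) = y $ p i * y $ p i" for i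
      using s[of i] by (cases "s i \<ge> 0") auto
    then have "?T y \<bullet> ?T y = (\<Sum>i\<in>UNIV. y $ p i * y $ p i)"
      by (simp only: inner_vec_def inner_real_def vec_lambda_beta)
    also have "\<dots> = y \<bullet> y"
      using sum.reindex_bij_betw[OF p, of "\<lambda>i. y $ i * y $ i"] by (simp add: inner_vec_def)
    finally show ?thesis by (simp add: norm_eq)
  qed
  have "(LINT y:ball 0 r|lborel. h y) = (LINT y:ball 0 r|distr lborel borel ?T. h y)"
    using lborel_distr_signed_permutation[OF p s] by simp
  also have "\<dots> = (LINT y|lborel. indicator (ball 0 r) (?T y) *\<^sub>R h (?T y))"
    unfolding set_lebesgue_integral_def using T h
    by (intro integral_distr borel_measurable_scaleR borel_measurable_indicator) auto
  also have "\<dots> = (LINT y:ball 0 r|lborel. h (?T y))"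
    unfolding set_lebesgue_integral_def by (simp add: indicator_def n)
  finally show ?thesis by simp
qed

section \<open>Integrals over balls: moments of order one and two\<close>

lemma set_integrable_ball_lborel:
  fixes h :: "'a::euclidean_space \<Rightarrow> 'b::{banach, second_countable_topology}"
  assumes "continuous_on (cball a r) h"
  shows "set_integrable lborel (ball a r) h"
proof (rule set_integrable_subset)
  show "set_integrable lborel (cball a r) h"
    unfolding set_integrable_def using assms by (intro borel_integrable_compact) auto
qed auto

text \<open>The recursion of \<open>Gamma\<close> at \<open>n / 2 + 1\<close>, together with one
  more factor \<open>pi\<close>. The two extra dimensions are those of the complex factor in the
  slicing below.\<close>

lemma unit_ball_vol_add_2:
  assumes "n \<ge> 0"
  shows "unit_ball_vol (n + 2) = 2 * pi / (n + 2) * unit_ball_vol n"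
proof -
  have "Gamma (n / 2 + 1 + 1) = (n / 2 + 1) * Gamma (n / 2 + 1)"
    using assms by (intro Gamma_plus1) (auto simp: nonpos_Ints_def)
  moreover have "(n + 2) / 2 + 1 = n / 2 + 1 + 1" by simp
  ultimately have "Gamma ((n + 2) / 2 + 1) = (n + 2) / 2 * Gamma (n / 2 + 1)"
    by (simp only:) simp
  moreover have "pi powr ((n + 2) / 2) = pi powr (n / 2) * pi"
    by (simp add: add_divide_distrib powr_add)
  ultimately show ?thesis unfolding unit_ball_vol_def by (simp only:) simp
qed

text \<open>
  Slicing the ball of \<open>'a \<times> complex\<close> over \<open>y\<close> gives discs of area \<open>\<pi> (r\<^sup>2 - |y|\<^sup>2)\<close>, so the moment
  can be read off from the ball volumes in dimensions \<open>n\<close> and \<open>n + 2\<close>.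
\<close>

lemma second_moment_ball:
  fixes r :: real
  assumes r: "r \<ge> 0"
  shows "(LINT y:ball (0::'a::euclidean_space) r|lborel. (norm y)\<^sup>2) =
    DIM('a) / (DIM('a) + 2) * r\<^sup>2 * measure lborel (ball (0::'a) r)"
proof -
  let ?B = "ball (0::'a) r"
  let ?g = "\<lambda>y::'a. indicator ?B y * (pi * (r\<^sup>2 - (norm y)\<^sup>2))"
  have gint: "integrable lborel ?g"
    unfolding real_scaleR_def[symmetric]
    by (intro continuous_intros set_integrable_ball_lborel[unfolded set_integrable_def])
  have gnn: "0 \<le> ?g y" for y
    by (auto simp: indicator_def intro!: mult_nonneg_nonneg power_mono)
  have slice: "emeasure lborel (Pair y -` ball (0::'a\<times>complex) r) = ennreal (?g y)" for y
  proof (cases "norm y < r")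
    case True
    then have y: "(norm y)\<^sup>2 < r\<^sup>2" by (intro power_strict_mono) auto
    have "norm (y, z) < r \<longleftrightarrow> norm z < sqrt (r\<^sup>2 - (norm y)\<^sup>2)" for z :: complex
    proof -
      have "norm (y, z) < r \<longleftrightarrow> sqrt ((norm y)\<^sup>2 + (norm z)\<^sup>2) < sqrt (r\<^sup>2)"
        using r by (simp add: norm_Pair)
      also have "\<dots> \<longleftrightarrow> (norm z)\<^sup>2 < r\<^sup>2 - (norm y)\<^sup>2"
        by (simp only: real_sqrt_less_iff) linarith
      also have "\<dots> \<longleftrightarrow> sqrt ((norm z)\<^sup>2) < sqrt (r\<^sup>2 - (norm y)\<^sup>2)"
        by (simp only: real_sqrt_less_iff)
      also have "\<dots> \<longleftrightarrow> norm z < sqrt (r\<^sup>2 - (norm y)\<^sup>2)" by simp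
      finally show ?thesis .
    qed
    then have "Pair y -` ball (0::'a\<times>complex) r = ball 0 (sqrt (r\<^sup>2 - (norm y)\<^sup>2))"
      by auto
    then show ?thesis
      using True y by (simp add: emeasure_ball unit_ball_vol_numeral)
  next
    case False
    then have "\<not> norm (y, z) < r" for z :: complex
      using norm_fst_le[of y z] by linarith
    then have "Pair y -` ball (0::'a\<times>complex) r = {}" by auto
    with False show ?thesis by simp
  qed
  have "ennreal (unit_ball_vol (DIM('a) + 2) * r ^ (DIM('a) + 2)) =
      emeasure (lborel \<Otimes>\<^sub>M lborel) (ball (0::'a\<times>complex) r)"
    using r by (subst lborel_prod) (simp add: emeasure_ball)
  also have "\<dots> = (\<integral>\<^sup>+y. ennreal (?g y) \<partial>lborel)"
    by (subst lborel.emeasure_pair_measure_alt)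
       (simp_all only: slice lborel_prod sets_lborel borel_open open_ball)
  also have "\<dots> = ennreal (LINT y|lborel. ?g y)"
    using gint gnn by (intro nn_integral_eq_integral) auto
  finally have "(LINT y|lborel. ?g y) = unit_ball_vol (DIM('a) + 2) * r ^ (DIM('a) + 2)"
    using r gnn by (subst (asm) ennreal_inj) (auto intro!: mult_nonneg_nonneg integral_nonneg_AE)
  also have "\<dots> = 2 * pi / (DIM('a) + 2) * r\<^sup>2 * measure lborel ?B"
    using r by (simp add: unit_ball_vol_add_2 content_ball power_add power2_eq_square field_simps)
  finally have 1: "(LINT y|lborel. ?g y) = 2 * pi / (DIM('a) + 2) * r\<^sup>2 * measure lborel ?B" .
  \<comment> \<open>Split by linearity, the same integral contains the wanted moment; equating it
    with the value from the volume formula and cancelling \<open>pi\<close> isolates the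
    moment.\<close>
  have "(LINT y|lborel. ?g y) = (LINT y:?B|lborel. pi * r\<^sup>2 - pi * (norm y)\<^sup>2)"
    by (simp add: set_lebesgue_integral_def right_diff_distrib)
  also have "\<dots> = (LINT y:?B|lborel. pi * r\<^sup>2) - (LINT y:?B|lborel. pi * (norm y)\<^sup>2)"
    by (intro set_integral_diff set_integrable_ball_lborel continuous_intros)
  also have "\<dots> = pi * r\<^sup>2 * measure lborel ?B - pi * (LINT y:?B|lborel. (norm y)\<^sup>2)"
    by (simp add: set_lebesgue_integral_def)
  finally have "pi * (LINT y:?B|lborel. (norm y)\<^sup>2) =
      pi * (r\<^sup>2 * measure lborel ?B - 2 / (DIM('a) + 2) * r\<^sup>2 * measure lborel ?B)"
    unfolding 1 by (simp add: algebra_simps)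
  then have "(LINT y:?B|lborel. (norm y)\<^sup>2) =
      r\<^sup>2 * measure lborel ?B - 2 / (DIM('a) + 2) * r\<^sup>2 * measure lborel ?B"
    by simp
  then show ?thesis by (simp add: field_simps)
qed

text \<open>The reflection in the origin makes the integral equal to its own negative.\<close>

lemma first_moments_ball:
  "(LINT y:ball 0 r|lborel. (y::real^'n) $ i) = 0"
proof -
  \<comment> \<open>Writing the reflection with \<open>id\<close>, kept unsimplified, gives the goal
    the shape of the invariance rule.\<close>
  have "(LINT y:ball 0 r|lborel. (\<chi> i. - 1 * (y::real^'n) $ id i) $ i) = (LINT y:ball 0 r|lborel. y $ i)"
    by (rule set_integral_ball_signed_permutation) (auto simp del: id_apply)
  then show ?thesis by (simp add: set_lebesgue_integral_def)
qed

text \<open>Off the diagonal, flipping the sign of coordinate \<open>i\<close> alone negates the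
  integrand. On the diagonal, interchanging coordinates makes all moments equal, so each is the
  moment of the squared norm divided by the dimension.\<close>

lemma second_moments_ball:
  assumes r: "r \<ge> 0"
  shows "(LINT y:ball 0 r|lborel. (y::real^'n) $ i * y $ j) =
    (if i = j then r\<^sup>2 / (CARD('n) + 2) * measure lborel (ball (0::real^'n) r) else 0)"
proof (cases "i = j")
  case False
  define s :: "'n \<Rightarrow> real" where "s k = (if k = i then - 1 else 1)" for k
  have "(LINT y:ball 0 r|lborel. (\<chi> k. s k * (y::real^'n) $ id k) $ i * (\<chi> k. s k * y $ id k) $ j) =
      (LINT y:ball 0 r|lborel. y $ i * y $ j)"
    by (rule set_integral_ball_signed_permutation) (auto simp: s_def simp del: id_apply)
  with False show ?thesis by (simp add: set_lebesgue_integral_def s_def)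
next
  case True
  let ?m = "\<lambda>i. LINT y:ball 0 r|lborel. (y::real^'n) $ i * y $ i"
  have "?m k = ?m i" for k
    using set_integral_ball_signed_permutation
      [of "Transposition.transpose i k" "\<lambda>_. 1" "\<lambda>y::real^'n. y $ i * y $ i" r]
    by simp
  then have "CARD('n) * ?m i = (\<Sum>k\<in>UNIV. ?m k)"
    by (subst sum.cong[OF refl, of _ _ "\<lambda>_. ?m i"]) auto
  also have "\<dots> = (LINT y:ball 0 r|lborel. (\<Sum>k\<in>UNIV. (y::real^'n) $ k * y $ k))"
    unfolding set_lebesgue_integral_def scaleR_sum_right
    by (intro Bochner_Integration.integral_sum[symmetric] continuous_intros
        set_integrable_ball_lborel[unfolded set_integrable_def])
  also have "\<dots> = (LINT y:ball (0::real^'n) r|lborel. (norm y)\<^sup>2)"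
    by (simp add: power2_norm_eq_inner inner_vec_def)
  finally show ?thesis
    using True by (simp add: second_moment_ball[OF r] eq_divide_eq mult.assoc)
qed

section \<open>Second-order Taylor expansion at a point\<close>

text \<open>\<open>gradient\<close> collects partial derivatives; linearity and the expansion of
  \<open>h\<close> in the standard basis recover the full derivative.\<close>

lemma frechet_derivative_eq_gradient:
  assumes "\<psi> differentiable (at z)"
  shows "frechet_derivative \<psi> (at z) h = gradient \<psi> z \<bullet> h"
proof -
  have lin: "linear (frechet_derivative \<psi> (at z))"
    using assms by (rule linear_frechet_derivative)
  have "frechet_derivative \<psi> (at z) h =
      frechet_derivative \<psi> (at z) (\<Sum>i\<in>UNIV. (h $ i) *\<^sub>R axis i 1)"
    by (simp add: basis_expansion flip: scalar_mult_eq_scaleR)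
  also have "\<dots> = (\<Sum>i\<in>UNIV. h $ i * frechet_derivative \<psi> (at z) (axis i 1))"
    using lin by (simp add: linear_sum linear_cmul)
  finally show ?thesis
    by (simp add: gradient_def inner_vec_def mult.commute)
qed

text \<open>
  Applying the mean value theorem along the ray \<open>t \<mapsto> x + t h\<close> avoids the symmetry of the Hessian.
\<close>

lemma second_order_taylor:
  fixes \<psi> :: "real^'n \<Rightarrow> real"
  assumes \<Omega>: "open \<Omega>" "x \<in> \<Omega>"
    and d1: "\<And>z. z \<in> \<Omega> \<Longrightarrow> \<psi> differentiable (at z)"
    and d2: "gradient \<psi> differentiable (at x)"
    and e: "e > 0"
  obtains d where "d > 0" "cball x d \<subseteq> \<Omega>"
    "\<And>h. norm h \<le> d \<Longrightarrow>
      \<bar>\<psi> (x + h) - \<psi> x - gradient \<psi> x \<bullet> h - h \<bullet> (hessian \<psi> x *v h) / 2\<bar> \<le> e * (norm h)\<^sup>2"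
proof -
  let ?g = "gradient \<psi>" and ?H = "hessian \<psi> x"
  obtain d0 where d0: "d0 > 0" "cball x d0 \<subseteq> \<Omega>"
    using \<Omega> open_contains_cball by blast
  have "(?g has_derivative ((*v) ?H)) (at x)"
    using d2[unfolded frechet_derivative_works] linear_frechet_derivative[OF d2]
    by (simp add: hessian_def matrix_vector_mul(2))
  then obtain d1 where d1': "d1 > 0"
    "\<And>y. norm (y - x) < d1 \<Longrightarrow> norm (?g y - ?g x - ?H *v (y - x)) \<le> e * norm (y - x)"
    using e unfolding has_derivative_at_alt by blast
  \<comment> \<open>Halving \<open>d1\<close> turns the weak bound \<open>norm h \<le> d\<close>
    into the strict one required by the gradient estimate.\<close>
  define d where "d = min d0 (d1 / 2)"
  show thesis
  proof
    show "d > 0" using d0 d1' by (simp add: d_def)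
    show "cball x d \<subseteq> \<Omega>" using d0 by (auto simp: d_def)
    fix h :: "real^'n"
    assume h: "norm h \<le> d"
    \<comment> \<open>\<open>?s 1 - ?s 0\<close> is the Taylor remainder, and \<open>?s' t\<close>
      pairs \<open>h\<close> with the error of the linear approximation of the gradient at
      \<open>x + t *\<^sub>R h\<close>, which differentiability at \<open>x\<close> makes
      small.\<close>
    let ?s = "\<lambda>t. \<psi> (x + t *\<^sub>R h) - t * (?g x \<bullet> h) - t\<^sup>2 * (h \<bullet> (?H *v h)) / 2"
    let ?s' = "\<lambda>t. (?g (x + t *\<^sub>R h) - ?g x - ?H *v (t *\<^sub>R h)) \<bullet> h"
    have "(?s has_real_derivative ?s' t) (at t)" if t: "0 \<le> t" "t \<le> 1" for t
    proof -
      have "norm (t *\<^sub>R h) \<le> d"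
        using h t mult_left_le_one_le[of "norm h" t] by simp
      then have "x + t *\<^sub>R h \<in> \<Omega>"
        using \<open>cball x d \<subseteq> \<Omega>\<close> by (auto simp: dist_norm)
      then have "(\<psi> has_derivative (\<lambda>k. ?g (x + t *\<^sub>R h) \<bullet> k)) (at (x + t *\<^sub>R h))"
        using d1 frechet_derivative_works frechet_derivative_eq_gradient
        by (metis (no_types, lifting) ext)
      moreover have "((\<lambda>t. x + t *\<^sub>R h) has_derivative (\<lambda>k. k *\<^sub>R h)) (at t)"
        by (auto intro!: derivative_eq_intros)
      ultimately have "((\<lambda>t. \<psi> (x + t *\<^sub>R h)) has_derivative (\<lambda>k. ?g (x + t *\<^sub>R h) \<bullet> (k *\<^sub>R h))) (at t)"
        using has_derivative_compose by blast
      then have "((\<lambda>t. \<psi> (x + t *\<^sub>R h)) has_real_derivative ?g (x + t *\<^sub>R h) \<bullet> h) (at t)"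
        by (simp add: has_field_derivative_def mult.commute[of _ "_ \<bullet> _"])
      then show ?thesis
        by (auto intro!: derivative_eq_intros
            simp: inner_diff_right matrix_vector_mult_scaleR inner_commute)
    qed
    then obtain t where t: "0 < t" "t < 1" "?s 1 - ?s 0 = (1 - 0) * ?s' t"
      using MVT2[of 0 1 ?s ?s'] by auto
    have th: "norm (t *\<^sub>R h) \<le> norm h"
      using t mult_left_le_one_le[of "norm h" t] by simp
    have "\<bar>?s' t\<bar> \<le> norm (?g (x + t *\<^sub>R h) - ?g x - ?H *v (t *\<^sub>R h)) * norm h"
      by (rule Cauchy_Schwarz_ineq2)
    also have "\<dots> \<le> (e * norm (t *\<^sub>R h)) * norm h"
      using d1'(2)[of "x + t *\<^sub>R h"] th h d1'(1)
      by (intro mult_right_mono) (auto simp: d_def simp del: norm_scaleR)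
    also have "\<dots> \<le> (e * norm h) * norm h"
      using th e by (intro mult_right_mono mult_left_mono) auto
    also have "\<dots> = e * (norm h)\<^sup>2" by (simp add: power2_eq_square)
    finally show "\<bar>\<psi> (x + h) - \<psi> x - ?g x \<bullet> h - h \<bullet> (?H *v h) / 2\<bar> \<le> e * (norm h)\<^sup>2"
      using t(3) by simp
  qed
qed

section \<open>Averages over the images of a ball under a matrix\<close>

lemma ball_average_add:
  assumes "continuous_on (cball 0 \<epsilon>) (\<lambda>y. v (x + A *v y))"
    and "continuous_on (cball 0 \<epsilon>) (\<lambda>y. w (x + A *v y))"
  shows "ball_average (\<lambda>z. v z + w z) \<epsilon> x A = ball_average v \<epsilon> x A + ball_average w \<epsilon> x A"
  using assms by (simp add: ball_average_def set_integral_add set_integrable_ball_lborel distrib_left)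

lemma ball_average_const:
  assumes "\<epsilon> > 0"
  shows "ball_average (\<lambda>z. c) \<epsilon> x A = c"
  using assms by (simp add: ball_average_def set_lebesgue_integral_def)

text \<open>Moving \<open>A\<close> to the other factor turns the integrand into a linear form in
  \<open>y\<close>, and the first moments of the ball vanish.\<close>

lemma ball_average_inner:
  "ball_average (\<lambda>z. g \<bullet> (z - x)) \<epsilon> x A = 0"
proof -
  have "g \<bullet> (A *v y) = (\<Sum>i\<in>UNIV. (g v* A) $ i * y $ i)" for y
    by (metis dot_lmul_matrix inner_vec_def inner_real_def)
  then have "(LINT y:ball 0 \<epsilon>|lborel. g \<bullet> (A *v y)) =
      (\<Sum>i\<in>UNIV. LINT y:ball 0 \<epsilon>|lborel. (g v* A) $ i * y $ i)"
    unfolding set_lebesgue_integral_def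
    by (simp only: scaleR_sum_right)
       (intro Bochner_Integration.integral_sum continuous_intros
         set_integrable_ball_lborel[unfolded set_integrable_def])
  then show ?thesis by (simp add: ball_average_def first_moments_ball)
qed

text \<open>Pulling back along \<open>A\<close> gives the quadratic form of
  \<open>transpose A ** M ** A\<close>; only its diagonal entries meet non-zero second moments,
  which leaves the trace.\<close>

lemma ball_average_quadratic:
  fixes A M :: "real^'n^'n"
  assumes e: "\<epsilon> > 0"
  shows "ball_average (\<lambda>z. (z - x) \<bullet> (M *v (z - x))) \<epsilon> x A =
    \<epsilon>\<^sup>2 / (CARD('n) + 2) * trace (transpose A ** M ** A)"
proof -
  let ?Q = "transpose A ** M ** A"
  have "(A *v y) \<bullet> (M *v (A *v y)) = y \<bullet> (?Q *v y)" for y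
    by (metis dot_lmul_matrix matrix_vector_mul_assoc vector_transpose_matrix)
  also have "y \<bullet> (?Q *v y) = (\<Sum>i\<in>UNIV. \<Sum>j\<in>UNIV. ?Q $ i $ j * (y $ i * y $ j))" for y
    by (simp add: inner_vec_def matrix_vector_mult_def sum_distrib_left mult_ac)
  finally have "(LINT y:ball 0 \<epsilon>|lborel. (A *v y) \<bullet> (M *v (A *v y))) =
      (LINT y:ball 0 \<epsilon>|lborel. \<Sum>i\<in>UNIV. \<Sum>j\<in>UNIV. ?Q $ i $ j * (y $ i * y $ j))"
    by simp
  also have "\<dots> = (\<Sum>i\<in>UNIV. LINT y:ball 0 \<epsilon>|lborel. \<Sum>j\<in>UNIV. ?Q $ i $ j * (y $ i * y $ j))"
    unfolding set_lebesgue_integral_def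
    by (subst scaleR_sum_right)
       (intro Bochner_Integration.integral_sum continuous_intros
         set_integrable_ball_lborel[unfolded set_integrable_def])
  also have "\<dots> = (\<Sum>i\<in>UNIV. \<Sum>j\<in>UNIV. LINT y:ball 0 \<epsilon>|lborel. ?Q $ i $ j * (y $ i * y $ j))"
    unfolding set_lebesgue_integral_def
    by (simp only: scaleR_sum_right)
       (intro sum.cong refl Bochner_Integration.integral_sum continuous_intros
         set_integrable_ball_lborel[unfolded set_integrable_def])
  also have "\<dots> = \<epsilon>\<^sup>2 / (CARD('n) + 2) * measure lborel (ball (0::real^'n) \<epsilon>) * trace ?Q"
  proof -
    have "(LINT y:ball 0 \<epsilon>|lborel. ?Q $ i $ j * (y $ i * y $ j)) = (if i = j then
        \<epsilon>\<^sup>2 / (CARD('n) + 2) * measure lborel (ball (0::real^'n) \<epsilon>) * ?Q $ i $ i else 0)" for i j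
      using e by (simp add: second_moments_ball)
    then show ?thesis
      by (simp only: trace_def sum_distrib_left) simp
  qed
  finally show ?thesis using e by (simp add: ball_average_def)
qed

lemma ball_average_abs_le:
  fixes A :: "real^'n^'n"
  assumes e: "\<epsilon> > 0" and c: "continuous_on (cball 0 \<epsilon>) (\<lambda>y. w (x + A *v y))"
    and b: "\<And>y. norm y < \<epsilon> \<Longrightarrow> \<bar>w (x + A *v y)\<bar> \<le> K"
  shows "\<bar>ball_average w \<epsilon> x A\<bar> \<le> K"
proof -
  let ?B = "ball (0::real^'n) \<epsilon>"
  have "\<bar>LINT y:?B|lborel. w (x + A *v y)\<bar> \<le> (LINT y:?B|lborel. \<bar>w (x + A *v y)\<bar>)"
    using set_integral_norm_bound[OF set_integrable_ball_lborel[OF c]] by simp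
  also have "\<dots> \<le> (LINT y:?B|lborel. K)"
    using b by (intro set_integral_mono set_integrable_ball_lborel continuous_intros c) auto
  also have "\<dots> = measure lborel ?B * K"
    by (simp add: set_lebesgue_integral_def)
  finally show ?thesis
    using e by (simp add: ball_average_def abs_mult divide_le_eq mult.commute)
qed

text \<open>One constant \<open>C\<close> serves all matrices in \<open>S\<close>, so a single
  Taylor radius controls the remainder on every image of the ball. This is why the quantifier over
  \<open>A\<close> can stand inside the eventuality.\<close>

lemma ball_average_expansion:
  fixes \<psi> :: "real^'n \<Rightarrow> real" and S :: "(real^'n^'n) set"
  assumes \<Omega>: "open \<Omega>" "x \<in> \<Omega>"
    and d1: "\<And>z. z \<in> \<Omega> \<Longrightarrow> \<psi> differentiable (at z)"
    and d2: "gradient \<psi> differentiable (at x)"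
    and S: "\<And>A y. A \<in> S \<Longrightarrow> norm (A *v y) \<le> C * norm y"
    and e: "e > 0"
  shows "\<forall>\<^sub>F \<epsilon> in at_right 0. \<forall>A\<in>S. \<bar>ball_average \<psi> \<epsilon> x A -
    (\<psi> x + \<epsilon>\<^sup>2 / (2 * (real CARD('n) + 2)) * trace (transpose A ** hessian \<psi> x ** A))\<bar> \<le> e * \<epsilon>\<^sup>2"
proof -
  \<comment> \<open>\<open>C\<close> may be zero or negative, whereas \<open>K\<close> is used as a
    divisor.\<close>
  define K where "K = max C 1"
  have K: "K > 0" by (simp add: K_def)
  have SK: "norm (A *v y) \<le> K * norm y" if "A \<in> S" for A y
    by (rule order_trans[OF S[OF that] mult_right_mono]) (auto simp: K_def)
  \<comment> \<open>The tolerance is divided by \<open>K\<^sup>2\<close> because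
    \<open>norm (A *v y)\<close> is at most \<open>K * \<epsilon>\<close>, whose square brings that
    factor back.\<close>
  obtain d where d: "d > 0" "cball x d \<subseteq> \<Omega>"
    and T: "\<And>h. norm h \<le> d \<Longrightarrow> \<bar>\<psi> (x + h) - \<psi> x - gradient \<psi> x \<bullet> h -
        h \<bullet> (hessian \<psi> x *v h) / 2\<bar> \<le> e / K\<^sup>2 * (norm h)\<^sup>2"
    using second_order_taylor[OF \<Omega> d1 d2, of "e / K\<^sup>2"] e K by auto
  have "\<forall>\<^sub>F \<epsilon> in at_right 0. 0 < \<epsilon> \<and> \<epsilon> < d / K"
    using d K by (auto simp: eventually_at_right_field intro!: exI[of _ "d / K"])
  then show ?thesis
  proof (eventually_elim, intro ballI)
    fix \<epsilon> :: real and A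
    assume \<epsilon>: "0 < \<epsilon> \<and> \<epsilon> < d / K" and A: "A \<in> S"
    let ?L = "\<lambda>z. gradient \<psi> x \<bullet> (z - x)"
    \<comment> \<open>The factor 1/2 sits inside the matrix, so that
      \<open>ball_average_quadratic\<close> applies with half the Hessian as
      \<open>M\<close>.\<close>
    let ?q = "\<lambda>z. (z - x) \<bullet> (((1/2) *\<^sub>R hessian \<psi> x) *v (z - x))"
    define w where "w z = \<psi> z - \<psi> x - ?L z - ?q z" for z
    have small: "norm (A *v y) \<le> K * \<epsilon>" if "norm y \<le> \<epsilon>" for y
      using order_trans[OF SK[OF A] mult_left_mono[OF that]] K by simp
    have "K * \<epsilon> \<le> d" using \<epsilon> K by (simp add: field_simps)
    have "continuous_on (cball x d) \<psi>"
      using d1 d(2) by (intro continuous_at_imp_continuous_on)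
        (auto intro: differentiable_imp_continuous_within)
    then have c\<psi>: "continuous_on (cball 0 \<epsilon>) (\<lambda>y. \<psi> (x + A *v y))"
      using small \<open>K * \<epsilon> \<le> d\<close>
      by (elim continuous_on_compose2) (intro continuous_intros, force simp: dist_norm)
    note cont = continuous_intros bounded_linear.continuous_on[OF matrix_vector_mul_bounded_linear]
    have cw: "continuous_on (cball 0 \<epsilon>) (\<lambda>y. w (x + A *v y))"
      unfolding w_def by (intro cont c\<psi>)
    have "ball_average (\<lambda>z. w z + (\<psi> x + (?L z + ?q z))) \<epsilon> x A =
        ball_average w \<epsilon> x A + (ball_average (\<lambda>z. \<psi> x) \<epsilon> x A +
          (ball_average ?L \<epsilon> x A + ball_average ?q \<epsilon> x A))"
      by (subst ball_average_add, (intro cont cw)+)+ simp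
    moreover have "(\<lambda>z. w z + (\<psi> x + (?L z + ?q z))) = \<psi>"
      by (simp add: w_def)
    moreover have "trace (transpose A ** ((1/2) *\<^sub>R hessian \<psi> x) ** A) =
        trace (transpose A ** hessian \<psi> x ** A) / 2"
      by (simp add: trace_def matrix_scalar_ac sum_divide_distrib flip: scalar_matrix_assoc)
    ultimately have "ball_average \<psi> \<epsilon> x A - (\<psi> x + \<epsilon>\<^sup>2 / (2 * (real CARD('n) + 2)) *
        trace (transpose A ** hessian \<psi> x ** A)) = ball_average w \<epsilon> x A"
      using \<epsilon> by (simp add: ball_average_const ball_average_inner ball_average_quadratic field_simps)
    moreover have "\<bar>ball_average w \<epsilon> x A\<bar> \<le> e * \<epsilon>\<^sup>2"
    proof (rule ball_average_abs_le)
      fix y :: "real^'n"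
      assume "norm y < \<epsilon>"
      then have Ay: "norm (A *v y) \<le> K * \<epsilon>" using small by simp
      have "\<bar>w (x + A *v y)\<bar> \<le> e / K\<^sup>2 * (norm (A *v y))\<^sup>2"
        using T[of "A *v y"] Ay \<open>K * \<epsilon> \<le> d\<close> by (simp add: w_def scaleR_matrix_vector_assoc[symmetric])
      also have "\<dots> \<le> e / K\<^sup>2 * (K * \<epsilon>)\<^sup>2"
        using Ay e by (intro mult_left_mono power_mono) auto
      also have "\<dots> = e * \<epsilon>\<^sup>2"
        using K by (simp add: power_mult_distrib)
      finally show "\<bar>w (x + A *v y)\<bar> \<le> e * \<epsilon>\<^sup>2" .
    qed (use \<epsilon> cw in auto)
    ultimately show "\<bar>ball_average \<psi> \<epsilon> x A - (\<psi> x + \<epsilon>\<^sup>2 / (2 * (real CARD('n) + 2)) *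
        trace (transpose A ** hessian \<psi> x ** A))\<bar> \<le> e * \<epsilon>\<^sup>2" by simp
  qed
qed

section \<open>Passage through supremum and infimum, and the expansion of the mean value\<close>

text \<open>Taking infima and then the supremum is monotone and commutes with increasing affine
  maps. The uniform bounds on \<open>g\<close> and \<open>t\<close> make the real infima and suprema
  genuine ones.\<close>

lemma sup_inf_le_affine:
  fixes g t :: "'a \<Rightarrow> real"
  assumes ne: "\<CC> \<noteq> {}" "\<And>\<A>. \<A> \<in> \<CC> \<Longrightarrow> \<A> \<noteq> {}"
    and c: "c > 0"
    and g: "\<And>A. A \<in> \<Union>\<CC> \<Longrightarrow> \<bar>g A\<bar> \<le> K" and t: "\<And>A. A \<in> \<Union>\<CC> \<Longrightarrow> \<bar>t A\<bar> \<le> K'"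
    and le: "\<And>A. A \<in> \<Union>\<CC> \<Longrightarrow> g A \<le> a + c * t A"
  shows "(SUP \<A>\<in>\<CC>. INF A\<in>\<A>. g A) \<le> a + c * (SUP \<A>\<in>\<CC>. INF A\<in>\<A>. t A)"
proof (rule cSUP_least[OF ne(1)])
  fix \<A> assume \<A>: "\<A> \<in> \<CC>"
  have bg: "bdd_below (g ` \<A>)"
    using g \<A> by (intro bdd_belowI2[of _ "-K"]) (auto simp: abs_le_iff minus_le_iff)
  have bt: "bdd_below (t ` \<B>)" if "\<B> \<in> \<CC>" for \<B>
    using t that by (intro bdd_belowI2[of _ "-K'"]) (auto simp: abs_le_iff minus_le_iff)
  \<comment> \<open>With the affine map inverted, the claim is a lower bound for \<open>t\<close> on
    \<open>\<A>\<close>, which passes to the infimum.\<close>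
  have "((INF A\<in>\<A>. g A) - a) / c \<le> (INF A\<in>\<A>. t A)"
  proof (rule cINF_greatest[OF ne(2)[OF \<A>]])
    fix A assume A: "A \<in> \<A>"
    have "(INF A\<in>\<A>. g A) \<le> a + c * t A"
      using cINF_lower[OF bg A] le[of A] A \<A> by (meson UnionI order_trans)
    then show "((INF A\<in>\<A>. g A) - a) / c \<le> t A"
      using c by (simp add: field_simps)
  qed
  also have "\<dots> \<le> (SUP \<A>\<in>\<CC>. INF A\<in>\<A>. t A)"
  \<comment> \<open>An infimum over a non-empty set is at most any of the values, so
    \<open>K'\<close> bounds the infima from above.\<close>
  proof (rule cSUP_upper[OF \<A>], rule bdd_aboveI2)
    fix \<B> assume \<B>: "\<B> \<in> \<CC>"
    then obtain A where "A \<in> \<B>" using ne(2) by blast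
    then show "(INF A\<in>\<B>. t A) \<le> K'"
      using cINF_lower[OF bt[OF \<B>]] t[of A] \<B> by fastforce
  qed
  finally show "(INF A\<in>\<A>. g A) \<le> a + c * (SUP \<A>\<in>\<CC>. INF A\<in>\<A>. t A)"
    using c by (simp add: field_simps)
qed

text \<open>Each half of the estimate is one use of the preceding monotonicity: once directly, once
  with \<open>g\<close> and \<open>t\<close> exchanged and the affine relation inverted.\<close>

lemma sup_inf_affine_close:
  fixes g t :: "'a \<Rightarrow> real"
  assumes ne: "\<CC> \<noteq> {}" "\<And>\<A>. \<A> \<in> \<CC> \<Longrightarrow> \<A> \<noteq> {}"
    and c: "c > 0" and t: "\<And>A. A \<in> \<Union>\<CC> \<Longrightarrow> \<bar>t A\<bar> \<le> K"
    and close: "\<And>A. A \<in> \<Union>\<CC> \<Longrightarrow> \<bar>g A - (a + c * t A)\<bar> \<le> e"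
  shows "\<bar>(SUP \<A>\<in>\<CC>. INF A\<in>\<A>. g A) - (a + c * (SUP \<A>\<in>\<CC>. INF A\<in>\<A>. t A))\<bar> \<le> e"
proof -
  have g: "\<bar>g A\<bar> \<le> e + \<bar>a\<bar> + c * K" if "A \<in> \<Union>\<CC>" for A
  proof -
    have "\<bar>c * t A\<bar> \<le> c * K"
      using t[OF that] c by (simp add: abs_mult)
    then show ?thesis using close[OF that] by linarith
  qed
  have "(SUP \<A>\<in>\<CC>. INF A\<in>\<A>. g A) \<le> (a + e) + c * (SUP \<A>\<in>\<CC>. INF A\<in>\<A>. t A)"
    using close by (intro sup_inf_le_affine[OF ne c g t]) (auto simp: abs_le_iff algebra_simps)
  moreover have "(SUP \<A>\<in>\<CC>. INF A\<in>\<A>. t A) \<le> (e - a) / c + 1 / c * (SUP \<A>\<in>\<CC>. INF A\<in>\<A>. g A)"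
  proof (rule sup_inf_le_affine[OF ne _ t g])
    fix A assume "A \<in> \<Union>\<CC>"
    then have "c * t A \<le> e - a + g A" using close[of A] by linarith
    then show "t A \<le> (e - a) / c + 1 / c * g A" using c by (simp add: field_simps)
  qed (use c in auto)
  then have "c * (SUP \<A>\<in>\<CC>. INF A\<in>\<A>. t A) \<le> e - a + (SUP \<A>\<in>\<CC>. INF A\<in>\<A>. g A)"
    using c by (simp add: pos_le_divide_eq mult.commute flip: add_divide_distrib)
  ultimately show ?thesis by linarith
qed

text \<open>The averages are uniformly close to an affine function of the traces, with offset
  \<open>\<psi> x\<close> and slope \<open>\<epsilon>\<^sup>2 / (2 * (real CARD('n) + 2))\<close>,
  and this closeness passes to the sup-inf. The term with \<open>f x\<close> enters exactly.\<close>

lemma mean_value_expansion: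
  fixes \<psi> f :: "real^'n \<Rightarrow> real" and \<AA> :: "real^'n \<Rightarrow> (real^'n^'n) set set"
  assumes \<Omega>: "open \<Omega>" "x \<in> \<Omega>" and C2: "C2_on \<Omega> \<psi>"
    and ne: "\<AA> x \<noteq> {}" "\<And>\<A>. \<A> \<in> \<AA> x \<Longrightarrow> \<A> \<noteq> {}"
    and bd: "bounded (\<Union>(\<AA> x))"
  shows "(\<lambda>\<epsilon>. mean_value \<AA> f \<psi> \<epsilon> x -
      (\<psi> x + \<epsilon>\<^sup>2 / (2 * (real CARD('n) + 2)) * (sup_inf_trace \<AA> x (hessian \<psi> x) - f x)))
    \<in> o[at_right 0](\<lambda>\<epsilon>. \<epsilon>\<^sup>2)"
proof (rule landau_o.smallI)
  fix e :: real
  assume e: "e > 0"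
  let ?t = "\<lambda>A. trace (transpose A ** hessian \<psi> x ** A)"
  obtain B where B: "\<And>A. A \<in> \<Union>(\<AA> x) \<Longrightarrow> norm A \<le> B"
    using bd unfolding bounded_iff by blast
  have S: "norm (A *v y) \<le> (real CARD('n) * real CARD('n) * B) * norm y" if "A \<in> \<Union>(\<AA> x)" for A y
  proof -
    \<comment> \<open>A crude bound through the entries suffices: what matters is that it does not
      depend on \<open>A\<close>.\<close>
    have "onorm ((*v) A) \<le> real CARD('n) * real CARD('n) * B"
    proof (rule onorm_le_matrix_component)
      fix i j
      have "\<bar>A $ i $ j\<bar> \<le> norm A"
        using component_le_norm_cart[of "A $ i" j] Finite_Cartesian_Product.norm_nth_le[of A i] by linarith
      then show "\<bar>A $ i $ j\<bar> \<le> B" using B[OF that] by linarith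
    qed
    then show ?thesis
      using onorm[OF matrix_vector_mul_bounded_linear, of A y]
      by (meson mult_right_mono norm_ge_zero order_trans)
  qed
  have "continuous_on UNIV ?t"
    unfolding trace_def matrix_matrix_mult_def transpose_def
    by (simp, intro continuous_intros)
  \<comment> \<open>The union need not be closed, so the continuous trace is bounded on its compact
    closure instead.\<close>
  then have "compact (?t ` closure (\<Union>(\<AA> x)))"
    using bd by (intro compact_continuous_image) (auto intro: continuous_on_subset)
  then obtain K where "\<forall>A\<in>closure (\<Union>(\<AA> x)). \<bar>?t A\<bar> \<le> K"
    by (auto dest!: compact_imp_bounded simp: bounded_iff)
  then have K: "\<bar>?t A\<bar> \<le> K" if "A \<in> \<Union>(\<AA> x)" for A
    using that closure_subset by blast
  have "\<forall>\<^sub>F \<epsilon> in at_right 0. \<forall>A\<in>\<Union>(\<AA> x). \<bar>ball_average \<psi> \<epsilon> x A -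
      (\<psi> x + \<epsilon>\<^sup>2 / (2 * (real CARD('n) + 2)) * ?t A)\<bar> \<le> e * \<epsilon>\<^sup>2"
    using C2 \<Omega> unfolding C2_on_def by (intro ball_average_expansion[OF \<Omega> _ _ S e]) auto
  then show "\<forall>\<^sub>F \<epsilon> in at_right 0. norm (mean_value \<AA> f \<psi> \<epsilon> x -
      (\<psi> x + \<epsilon>\<^sup>2 / (2 * (real CARD('n) + 2)) * (sup_inf_trace \<AA> x (hessian \<psi> x) - f x)))
      \<le> e * norm (\<epsilon>\<^sup>2)"
    using eventually_at_right_less[of 0]
  proof eventually_elim
    case (elim \<epsilon>)
    \<comment> \<open>The slope is positive because \<open>\<epsilon>\<close> is eventually positive
      at the right of 0.\<close>
    have "\<bar>(SUP \<A>\<in>\<AA> x. INF A\<in>\<A>. ball_average \<psi> \<epsilon> x A) - (\<psi> x +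
        \<epsilon>\<^sup>2 / (2 * (real CARD('n) + 2)) * (SUP \<A>\<in>\<AA> x. INF A\<in>\<A>. ?t A))\<bar> \<le> e * \<epsilon>\<^sup>2"
      using elim by (intro sup_inf_affine_close[OF ne _ K]) auto
    then show ?case
      by (simp add: mean_value_def sup_inf_trace_def right_diff_distrib)
  qed
qed

section \<open>Reading off the sign of the second-order coefficient\<close>

text \<open>A remainder of smaller order than \<open>\<epsilon>\<^sup>2\<close> can absorb the
  expansion error but not a negative multiple of \<open>\<epsilon>\<^sup>2\<close>.\<close>

lemma ex_small_o_le_iff:
  fixes m :: "real \<Rightarrow> real"
  assumes k: "k > 0" and R: "(\<lambda>\<epsilon>. m \<epsilon> - (a + \<epsilon>\<^sup>2 / k * D)) \<in> o[at_right 0](\<lambda>\<epsilon>. \<epsilon>\<^sup>2)"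
  shows "(\<exists>r \<in> o[at_right 0](\<lambda>\<epsilon>. \<epsilon>\<^sup>2). \<forall>\<^sub>F \<epsilon> in at_right 0. a \<le> m \<epsilon> + r \<epsilon>) \<longleftrightarrow> 0 \<le> D"
proof
  assume "0 \<le> D"
  \<comment> \<open>The witness for \<open>r\<close> is the negated expansion error; adding it
    leaves exactly \<open>a + \<epsilon>\<^sup>2 / k * D\<close>.\<close>
  then have "a \<le> m \<epsilon> + - (m \<epsilon> - (a + \<epsilon>\<^sup>2 / k * D))" for \<epsilon> using k by simp
  then show "\<exists>r \<in> o[at_right 0](\<lambda>\<epsilon>. \<epsilon>\<^sup>2). \<forall>\<^sub>F \<epsilon> in at_right 0. a \<le> m \<epsilon> + r \<epsilon>"
    using R by (intro bexI[of _ "\<lambda>\<epsilon>. - (m \<epsilon> - (a + \<epsilon>\<^sup>2 / k * D))"]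
        always_eventually allI landau_o.small.uminus_in_iff[THEN iffD2])
next
  assume "\<exists>r \<in> o[at_right 0](\<lambda>\<epsilon>. \<epsilon>\<^sup>2). \<forall>\<^sub>F \<epsilon> in at_right 0. a \<le> m \<epsilon> + r \<epsilon>"
  then obtain r where r: "r \<in> o[at_right 0](\<lambda>\<epsilon>. \<epsilon>\<^sup>2)" "\<forall>\<^sub>F \<epsilon> in at_right 0. a \<le> m \<epsilon> + r \<epsilon>"
    by blast
  show "0 \<le> D"
  proof (rule ccontr)
    assume "\<not> 0 \<le> D"
    \<comment> \<open>With half of \<open>- D / k\<close> as tolerance, the expansion error and
      \<open>r\<close> together offset at most half of the negative term.\<close>
    then have "- D / (2 * k) > 0" using k by (intro divide_pos_pos) auto
    from landau_o.smallD[OF sum_in_smallo(1)[OF R r(1)] this] r(2) eventually_at_right_less[of 0]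
    have "\<forall>\<^sub>F \<epsilon> in at_right (0::real). False"
    proof eventually_elim
      case (elim \<epsilon>)
      have "0 \<le> \<epsilon>\<^sup>2 / k * D + - D / (2 * k) * \<epsilon>\<^sup>2"
        using elim unfolding real_norm_def abs_power2 by linarith
      also have "\<dots> = \<epsilon>\<^sup>2 / k * (D / 2)" using k by (simp add: field_simps)
      also have "\<dots> < 0" using elim k \<open>\<not> 0 \<le> D\<close> by (intro mult_pos_neg) auto
      finally show False by simp
    qed
    \<comment> \<open>The filter \<open>at_right 0\<close> on the reals is non-trivial.\<close>
    then show False by simp
  qed
qed

text \<open>Negating \<open>m\<close>, \<open>a\<close> and \<open>D\<close> reduces this to the
  preceding equivalence, since remainders of smaller order are closed under negation.\<close>

lemma ex_small_o_ge_iff: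
  fixes m :: "real \<Rightarrow> real"
  assumes k: "k > 0" and R: "(\<lambda>\<epsilon>. m \<epsilon> - (a + \<epsilon>\<^sup>2 / k * D)) \<in> o[at_right 0](\<lambda>\<epsilon>. \<epsilon>\<^sup>2)"
  shows "(\<exists>r \<in> o[at_right 0](\<lambda>\<epsilon>. \<epsilon>\<^sup>2). \<forall>\<^sub>F \<epsilon> in at_right 0. a \<ge> m \<epsilon> + r \<epsilon>) \<longleftrightarrow> D \<le> 0"
proof -
  have "(\<lambda>\<epsilon>. - (m \<epsilon> - (a + \<epsilon>\<^sup>2 / k * D))) \<in> o[at_right 0](\<lambda>\<epsilon>. \<epsilon>\<^sup>2)"
    using R by (simp only: landau_o.small.uminus_in_iff)
  then have "(\<lambda>\<epsilon>. - m \<epsilon> - (- a + \<epsilon>\<^sup>2 / k * - D)) \<in> o[at_right 0](\<lambda>\<epsilon>. \<epsilon>\<^sup>2)"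
    by (simp add: algebra_simps)
  from ex_small_o_le_iff[OF k this]
  have "(\<exists>r \<in> o[at_right 0](\<lambda>\<epsilon>. \<epsilon>\<^sup>2). \<forall>\<^sub>F \<epsilon> in at_right 0. - a \<le> - m \<epsilon> + r \<epsilon>) \<longleftrightarrow> D \<le> 0"
    by simp
  moreover have "(\<exists>r \<in> o[at_right 0](\<lambda>\<epsilon>. \<epsilon>\<^sup>2). \<forall>\<^sub>F \<epsilon> in at_right 0. - a \<le> - m \<epsilon> + r \<epsilon>) \<longleftrightarrow>
      (\<exists>r \<in> o[at_right 0](\<lambda>\<epsilon>. \<epsilon>\<^sup>2). \<forall>\<^sub>F \<epsilon> in at_right 0. a \<ge> m \<epsilon> + r \<epsilon>)"
    (is "?P \<longleftrightarrow> ?Q")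
  proof
    assume ?P
    then obtain r where "r \<in> o[at_right 0](\<lambda>\<epsilon>. \<epsilon>\<^sup>2)" "\<forall>\<^sub>F \<epsilon> in at_right 0. - a \<le> - m \<epsilon> + r \<epsilon>" by blast
    then show ?Q
      by (intro bexI[of _ "\<lambda>\<epsilon>. - r \<epsilon>"]) (auto elim: eventually_mono)
  next
    assume ?Q
    then obtain r where "r \<in> o[at_right 0](\<lambda>\<epsilon>. \<epsilon>\<^sup>2)" "\<forall>\<^sub>F \<epsilon> in at_right 0. a \<ge> m \<epsilon> + r \<epsilon>" by blast
    then show ?P
      by (intro bexI[of _ "\<lambda>\<epsilon>. - r \<epsilon>"]) (auto elim: eventually_mono)
  qed
  ultimately show ?thesis by simp
qed

theorem theorem1p7:
  fixes \<Omega> :: "(real ^ 'n) set"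
    and f u :: "real ^ 'n \<Rightarrow> real"
    and \<AA> :: "real ^ 'n \<Rightarrow> (real ^ 'n ^ 'n) set set"
  assumes "open \<Omega>"
    and "continuous_on \<Omega> f"
    and "\<And>x. x \<in> \<Omega> \<Longrightarrow> \<AA> x \<noteq> {}"
    and "\<And>x \<A>. x \<in> \<Omega> \<Longrightarrow> \<A> \<in> \<AA> x \<Longrightarrow> \<A> \<subseteq> psd_matrices"
    and "\<And>x \<A>. x \<in> \<Omega> \<Longrightarrow> \<A> \<in> \<AA> x \<Longrightarrow> \<A> \<noteq> {}"
    and "\<And>x. x \<in> \<Omega> \<Longrightarrow> bounded (\<Union>(\<AA> x))"
    and "continuous_on \<Omega> u"
  shows "(viscosity_subsolution \<Omega> (sup_inf_trace \<AA>) f u \<longleftrightarrow> mean_value_sub_viscosity \<Omega> \<AA> f u) \<and>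
         (viscosity_supersolution \<Omega> (sup_inf_trace \<AA>) f u \<longleftrightarrow> mean_value_super_viscosity \<Omega> \<AA> f u)"
proof -
  have k: "2 * (real CARD('n) + 2) > 0" by simp
  have "(\<exists>r \<in> o[at_right 0](\<lambda>\<epsilon>. \<epsilon>\<^sup>2). \<forall>\<^sub>F \<epsilon> in at_right 0. \<psi> x \<le> mean_value \<AA> f \<psi> \<epsilon> x + r \<epsilon>) \<longleftrightarrow>
      f x \<le> sup_inf_trace \<AA> x (hessian \<psi> x)" (is "?sub \<psi> x")
    and "(\<exists>r \<in> o[at_right 0](\<lambda>\<epsilon>. \<epsilon>\<^sup>2). \<forall>\<^sub>F \<epsilon> in at_right 0. \<psi> x \<ge> mean_value \<AA> f \<psi> \<epsilon> x + r \<epsilon>) \<longleftrightarrow>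
      sup_inf_trace \<AA> x (hessian \<psi> x) \<le> f x" (is "?super \<psi> x")
    if x: "x \<in> \<Omega>" and \<psi>: "C2_on \<Omega> \<psi>" for x \<psi>
  proof -
    \<comment> \<open>In the sign comparison, \<open>a\<close> becomes \<open>\<psi> x\<close> and
      \<open>D\<close> becomes
      \<open>sup_inf_trace \<AA> x (hessian \<psi> x) - f x\<close>.\<close>
    note expansion = mean_value_expansion[where f = f and \<AA> = \<AA> and x = x,
        OF assms(1) x \<psi> assms(3)[OF x] assms(5)[OF x] assms(6)[OF x]]
    show "?sub \<psi> x" "?super \<psi> x"
      using ex_small_o_le_iff[OF k expansion] ex_small_o_ge_iff[OF k expansion] by auto
  qed
  then show ?thesis
    unfolding viscosity_subsolution_def viscosity_supersolution_def
      mean_value_sub_viscosity_def mean_value_super_viscosity_def by auto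
qed

end
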